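(* Let $R$ be a Euclidean domain. There is a well-ordering $\prec$ on $R-\{0\}$ such that with respect to this ordering the identity map on $R-\{0\}$ is a (possibly transfinite) Euclidean norm for $R$.
   Context: Rings are associative, commutative and unital; $\mathbb{N}$ contains $0$. Let $R$ be an integral domain and $(I,<)$ a well-ordered set. A function $\varphi\colon R-\{0\}\to I$ is a (possibly transfinite) Euclidean norm on $R$ if for each pair $(a,b)\in R^2$ with $b\neq 0$ and $b\nmid a$ there exists some $q\in R$ with $\varphi(a-qb)<\varphi(b)$. The domain $R$ is a Euclidean domain if it has a Euclidean norm with values in $(\mathbb{N},<)$. *)

theory Defs
  imports "HOL-Algebra.Ring_Divisibility"
begin

text \<open>
  Well-ordered sets are given as a carrier \<open>I\<close> with a reflexive relation \<open>r\<close> satisfying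
  \<^const>\<open>well_order_on\<close>, the library's convention; the strict order is \<open>r - Id\<close>.
  The norm is a total function whose value at \<open>\<zero>\<close> is irrelevant: it is only used at \<open>b\<close> and at
  \<open>a \<ominus> q \<otimes> b\<close>, both nonzero under the hypotheses on \<open>a\<close> and \<open>b\<close>.
\<close>

definition euclidean_norm ::
    "('a, 'b) ring_scheme \<Rightarrow> 'i set \<Rightarrow> 'i rel \<Rightarrow> ('a \<Rightarrow> 'i) \<Rightarrow> bool" where
  "euclidean_norm R I r \<phi> \<longleftrightarrow>
     domain R \<and> well_order_on I r \<and> \<phi> \<in> carrier R - {\<zero>\<^bsub>R\<^esub>} \<rightarrow> I \<and>
     (\<forall>a\<in>carrier R. \<forall>b\<in>carrier R. b \<noteq> \<zero>\<^bsub>R\<^esub> \<longrightarrow> \<not> b divides\<^bsub>R\<^esub> a \<longrightarrow>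
        (\<exists>q\<in>carrier R. (\<phi> (a \<ominus>\<^bsub>R\<^esub> q \<otimes>\<^bsub>R\<^esub> b), \<phi> b) \<in> r - Id))"

definition is_euclidean_domain :: "('a, 'b) ring_scheme \<Rightarrow> bool" where
  "is_euclidean_domain R \<longleftrightarrow> (\<exists>\<phi>. euclidean_norm R (UNIV :: nat set) natLeq \<phi>)"

text \<open>This agrees with the locale \<^locale>\<open>euclidean_domain\<close> of the library.\<close>

lemma is_euclidean_domain_iff:
  "is_euclidean_domain R \<longleftrightarrow> (\<exists>\<phi>. euclidean_domain R \<phi>)"
proof
  assume "is_euclidean_domain R"
  then obtain \<phi> where N: "euclidean_norm R (UNIV :: nat set) natLeq \<phi>"
    unfolding is_euclidean_domain_def by blast
  then interpret domain R by (simp add: euclidean_norm_def)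
  have "euclidean_domain R \<phi>"
  proof (rule euclidean_domainI)
    fix a b assume ab: "a \<in> carrier R - {\<zero>\<^bsub>R\<^esub>}" "b \<in> carrier R - {\<zero>\<^bsub>R\<^esub>}"
    then have aR: "a \<in> carrier R" and bR: "b \<in> carrier R" by auto
    show "\<exists>q r. q \<in> carrier R \<and> r \<in> carrier R \<and>
        a = (b \<otimes>\<^bsub>R\<^esub> q) \<oplus>\<^bsub>R\<^esub> r \<and> (r = \<zero>\<^bsub>R\<^esub> \<or> \<phi> r < \<phi> b)"
    proof (cases "b divides\<^bsub>R\<^esub> a")
      case True
      then obtain q where "q \<in> carrier R" "a = b \<otimes>\<^bsub>R\<^esub> q" by (auto simp: factor_def)
      then show ?thesis using ab by (intro exI[of _ q] exI[of _ "\<zero>\<^bsub>R\<^esub>"]) auto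
    next
      case False
      then have "\<exists>q\<in>carrier R. (\<phi> (a \<ominus>\<^bsub>R\<^esub> q \<otimes>\<^bsub>R\<^esub> b), \<phi> b) \<in> natLeq - Id"
        using N ab unfolding euclidean_norm_def by blast
      then obtain q where q: "q \<in> carrier R" "\<phi> (a \<ominus>\<^bsub>R\<^esub> q \<otimes>\<^bsub>R\<^esub> b) < \<phi> b"
        by (auto simp: natLeq_def)
      have "a = (b \<otimes>\<^bsub>R\<^esub> q) \<oplus>\<^bsub>R\<^esub> (a \<ominus>\<^bsub>R\<^esub> q \<otimes>\<^bsub>R\<^esub> b)"
        using aR bR q(1) by algebra
      moreover have "a \<ominus>\<^bsub>R\<^esub> q \<otimes>\<^bsub>R\<^esub> b \<in> carrier R" using ab q(1) by simp
      ultimately show ?thesis using q by blast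
    qed
  qed
  then show "\<exists>\<phi>. euclidean_domain R \<phi>" by blast
next
  assume "\<exists>\<phi>. euclidean_domain R \<phi>"
  then obtain \<phi> where "euclidean_domain R \<phi>" by blast
  then interpret euclidean_domain R \<phi> .
  have "\<exists>q\<in>carrier R. \<phi> (a \<ominus>\<^bsub>R\<^esub> q \<otimes>\<^bsub>R\<^esub> b) < \<phi> b"
    if ab: "a \<in> carrier R" "b \<in> carrier R" "b \<noteq> \<zero>\<^bsub>R\<^esub>" "\<not> b divides\<^bsub>R\<^esub> a" for a b
  proof -
    have "a \<noteq> \<zero>\<^bsub>R\<^esub>" using ab divides_zero by blast
    then obtain q r where q: "q \<in> carrier R" "r \<in> carrier R" "a = (b \<otimes>\<^bsub>R\<^esub> q) \<oplus>\<^bsub>R\<^esub> r"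
      and r: "r = \<zero>\<^bsub>R\<^esub> \<or> \<phi> r < \<phi> b"
      using euclidean_function[of a b] ab by blast
    have "r \<noteq> \<zero>\<^bsub>R\<^esub>" using q ab by (auto simp: factor_def)
    moreover have "a \<ominus>\<^bsub>R\<^esub> q \<otimes>\<^bsub>R\<^esub> b = r" unfolding q(3) using q(1,2) ab(2) by algebra
    ultimately show ?thesis using q(1) r by metis
  qed
  moreover have "well_order_on UNIV natLeq"
    using natLeq_Well_order by (simp add: Field_natLeq)
  ultimately have "euclidean_norm R (UNIV :: nat set) natLeq \<phi>"
    using domain_axioms unfolding euclidean_norm_def
    by (simp add: natLeq_def) (metis less_imp_le less_irrefl)
  then show "is_euclidean_domain R" unfolding is_euclidean_domain_def by blast
qed

end

theory Submission imports Defs begin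

text \<open>Being a Euclidean norm only requires that certain pairs (remainder, divisor) be strictly
  decreasing. So any well-ordering of the nonzero elements that contains every strict comparison by
  \<phi> will serve. \<open>ex_well_order_on_refining\<close> supplies one: well-order each fibre of
  \<phi> and stack the fibres in the order of their \<phi>-values. Fibres may be infinite, so the
  resulting order type can exceed that of the natural numbers.\<close>

text \<open>
  Order the nonzero elements lexicographically: first by the given Euclidean norm, then by an
  arbitrary well-ordering. A remainder of smaller norm is then itself smaller.
\<close>

lemma ex_well_order_on_refining:
  fixes f :: "'a \<Rightarrow> 'i::wellorder"
  obtains r where "well_order_on A r"
    and "\<And>x y. x \<in> A \<Longrightarrow> y \<in> A \<Longrightarrow> f x < f y \<Longrightarrow> (x, y) \<in> r - Id"
proof -
  \<comment> \<open>The well-ordering theorem gives \<open>w\<close>, which only breaks ties inside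
    a fibre of \<open>f\<close>.\<close>
  obtain w where w: "well_order_on A w" using well_order_on by blast
  define r where
    "r = {(x, y). x \<in> A \<and> y \<in> A \<and> (f x < f y \<or> f x = f y \<and> (x, y) \<in> w)}"
  have refl: "\<And>x. x \<in> A \<Longrightarrow> (x, x) \<in> w"
    and trans: "\<And>x y z. (x, y) \<in> w \<Longrightarrow> (y, z) \<in> w \<Longrightarrow> (x, z) \<in> w"
    and antisym: "\<And>x y. (x, y) \<in> w \<Longrightarrow> (y, x) \<in> w \<Longrightarrow> x = y"
    and total: "\<And>x y. x \<in> A \<Longrightarrow> y \<in> A \<Longrightarrow> x \<noteq> y \<Longrightarrow> (x, y) \<in> w \<or> (y, x) \<in> w"
    and wf_w: "wf (w - Id)"
    using w unfolding order_on_defs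
    by (auto simp: refl_on_def total_on_def elim: transE dest: antisymD)
  \<comment> \<open>Along x \<mapsto> (f x, x) the strict part of \<open>r\<close> lands in a
    lexicographic product: at a tie in \<open>f\<close>, distinctness of the two elements puts the
    pair in \<open>w - Id\<close>. Well-foundedness then pulls back from the product.\<close>
  have "r - Id \<subseteq> inv_image ({(i, j). i < j} <*lex*> (w - Id)) (\<lambda>x. (f x, x))"
    by (auto simp: r_def)
  then have "wf (r - Id)"
    using wf_w by (meson wf wf_lex_prod wf_inv_image wf_subset)
  moreover have "linear_order_on A r"
    unfolding order_on_defs
  proof (intro conjI)
    show "refl_on A r" by (auto simp: refl_on_def r_def refl)
    show "trans r" by (rule transI) (auto simp: r_def intro: trans)
    show "antisym r" by (rule antisymI) (auto simp: r_def intro: antisym)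
    show "total_on A r" using total by (fastforce simp: total_on_def r_def)
  qed (auto simp: r_def)
  ultimately have "well_order_on A r" by (simp add: well_order_on_def)
  moreover have "(x, y) \<in> r - Id" if "x \<in> A" "y \<in> A" "f x < f y" for x y
    using that by (auto simp: r_def)
  ultimately show ?thesis by (rule that)
qed

theorem proposition1p2:
  fixes R :: "('a, 'b) ring_scheme"
  assumes "is_euclidean_domain R"
  shows "\<exists>r. well_order_on (carrier R - {\<zero>\<^bsub>R\<^esub>}) r \<and>
             euclidean_norm R (carrier R - {\<zero>\<^bsub>R\<^esub>}) r id"
proof -
  obtain \<phi> :: "'a \<Rightarrow> nat" where \<phi>: "euclidean_norm R UNIV natLeq \<phi>"
    using assms unfolding is_euclidean_domain_def by blast
  then interpret domain R by (simp add: euclidean_norm_def)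
  obtain r where r: "well_order_on (carrier R - {\<zero>\<^bsub>R\<^esub>}) r"
    and less: "\<And>x y. x \<in> carrier R - {\<zero>\<^bsub>R\<^esub>} \<Longrightarrow> y \<in> carrier R - {\<zero>\<^bsub>R\<^esub>} \<Longrightarrow>
      \<phi> x < \<phi> y \<Longrightarrow> (x, y) \<in> r - Id"
    using ex_well_order_on_refining[of "carrier R - {\<zero>\<^bsub>R\<^esub>}" \<phi>] by blast
  have "\<exists>q\<in>carrier R. (a \<ominus>\<^bsub>R\<^esub> q \<otimes>\<^bsub>R\<^esub> b, b) \<in> r - Id"
    if ab: "a \<in> carrier R" "b \<in> carrier R" "b \<noteq> \<zero>\<^bsub>R\<^esub>" "\<not> b divides\<^bsub>R\<^esub> a" for a b
  proof -
    obtain q where q: "q \<in> carrier R"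
      and "(\<phi> (a \<ominus>\<^bsub>R\<^esub> q \<otimes>\<^bsub>R\<^esub> b), \<phi> b) \<in> natLeq - Id"
      using \<phi> ab unfolding euclidean_norm_def by blast
    then have "\<phi> (a \<ominus>\<^bsub>R\<^esub> q \<otimes>\<^bsub>R\<^esub> b) < \<phi> b" by (auto simp: natLeq_def)
    \<comment> \<open>The order \<open>r\<close> lives on nonzero elements, so \<open>less\<close>
      applies only to a nonzero remainder; a zero remainder would make \<open>b\<close> divide
      \<open>a\<close>.\<close>
    moreover have "a \<ominus>\<^bsub>R\<^esub> q \<otimes>\<^bsub>R\<^esub> b \<noteq> \<zero>\<^bsub>R\<^esub>"
    proof
      assume "a \<ominus>\<^bsub>R\<^esub> q \<otimes>\<^bsub>R\<^esub> b = \<zero>\<^bsub>R\<^esub>"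
      then have "a = b \<otimes>\<^bsub>R\<^esub> q"
        using ab q by (simp add: m_comm)
      then show False using ab(4) q by (auto simp: factor_def)
    qed
    ultimately show ?thesis using less ab q by blast
  qed
  then have "euclidean_norm R (carrier R - {\<zero>\<^bsub>R\<^esub>}) r id"
    using r domain_axioms by (simp add: euclidean_norm_def)
  with r show ?thesis by blast
qed

end
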